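(* Let $\pi\in S_k$ be a permutation such that the entries $1$ and $2$ are not in adjacent positions (i.e. $|\pi^{-1}(1)-\pi^{-1}(2)|\ge 2$). Let $\pi'\in S_{k-2}$ be the permutation obtained by removing the entries $1$ and $2$ from the sequence $\pi(1),\dots,\pi(k)$ and then normalizing. Then for every integer $n>1$, $$g(\pi,n)\le 42(\log_2 n)\cdot g(\pi',n).$$
   Context: For $\sigma\in S_m$, a $\sigma$-wave is an increasing sequence of integers $x_1<\cdots<x_{m+1}$ such that for all $1\le i,j\le m$, $x_{i+1}-x_i > x_{j+1}-x_j$ if and only if $\sigma(i)>\sigma(j)$. $g(\sigma,n)$ is the largest cardinality of a subset of $[n]=\{1,\dots,n\}$ containing no $\sigma$-wave. The normalization of a sequence of distinct integers $y_1,\dots,y_m$ is the unique $\tau\in S_m$ with $\tau(i)>\tau(j)$ iff $y_i>y_j$. *)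

theory Defs
  imports Complex_Main "HOL-Combinatorics.Permutations"
begin

text \<open>A permutation \<open>\<sigma> \<in> S\<^sub>m\<close> is a function \<open>\<sigma> :: nat \<Rightarrow> nat\<close> with \<open>\<sigma> permutes {1..m}\<close>. The degree
  \<open>m\<close> cannot be recovered from the function, so it is passed explicitly. Only the values \<open>x 1\<close>, ...,
  \<open>x (m + 1)\<close> of a sequence \<open>x\<close> are relevant.\<close>

definition is_wave :: "nat \<Rightarrow> (nat \<Rightarrow> nat) \<Rightarrow> (nat \<Rightarrow> int) \<Rightarrow> bool" where
  "is_wave m \<sigma> x \<longleftrightarrow>
     strict_mono_on {1..m + 1} x \<and>
     (\<forall>i\<in>{1..m}. \<forall>j\<in>{1..m}. x (i + 1) - x i > x (j + 1) - x j \<longleftrightarrow> \<sigma> i > \<sigma> j)"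

definition contains_wave :: "nat \<Rightarrow> (nat \<Rightarrow> nat) \<Rightarrow> int set \<Rightarrow> bool" where
  "contains_wave m \<sigma> A \<longleftrightarrow> (\<exists>x. is_wave m \<sigma> x \<and> x ` {1..m + 1} \<subseteq> A)"

definition wave_g :: "nat \<Rightarrow> (nat \<Rightarrow> nat) \<Rightarrow> nat \<Rightarrow> nat" where
  "wave_g m \<sigma> n = Max {card A | A. A \<subseteq> {1..int n} \<and> \<not> contains_wave m \<sigma> A}"

text \<open>The maximum is over a finite nonempty set.\<close>

lemma wave_g_wf:
  "finite {card A | A. A \<subseteq> {1..int n} \<and> \<not> contains_wave m \<sigma> A}"
  "{card A | A. A \<subseteq> {1..int n} \<and> \<not> contains_wave m \<sigma> A} \<noteq> {}"
proof -
  have "{card A | A. A \<subseteq> {1..int n} \<and> \<not> contains_wave m \<sigma> A} \<subseteq> card ` Pow {1..int n}"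
    by auto
  then show "finite {card A | A. A \<subseteq> {1..int n} \<and> \<not> contains_wave m \<sigma> A}"
    by (rule finite_subset) simp
  have "\<not> contains_wave m \<sigma> {}"
    by (simp add: contains_wave_def)
  then show "{card A | A. A \<subseteq> {1..int n} \<and> \<not> contains_wave m \<sigma> A} \<noteq> {}"
    by blast
qed

text \<open>List positions are 0-based, positions of permutations are 1-based; hence the shift.\<close>

definition normalizes :: "(nat \<Rightarrow> nat) \<Rightarrow> 'a::linorder list \<Rightarrow> bool" where
  "normalizes \<tau> ys \<longleftrightarrow>
     \<tau> permutes {1..length ys} \<and>
     (\<forall>i\<in>{1..length ys}. \<forall>j\<in>{1..length ys}. \<tau> i > \<tau> j \<longleftrightarrow> ys ! (i - 1) > ys ! (j - 1))"

definition normalization :: "'a::linorder list \<Rightarrow> nat \<Rightarrow> nat" where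
  "normalization ys = (THE \<tau>. normalizes \<tau> ys)"

lemma normalizes_eq_card:
  assumes "normalizes \<tau> ys" and "i \<in> {1..length ys}"
  shows "\<tau> i = card {j \<in> {1..length ys}. ys ! (j - 1) \<le> ys ! (i - 1)}"
proof -
  let ?S = "{1..length ys}"
  have perm: "\<tau> permutes ?S"
    using assms(1) by (simp add: normalizes_def)
  have img: "\<tau> ` ?S = ?S"
    using perm by (rule permutes_image)
  have eq: "{j \<in> ?S. ys ! (j - 1) \<le> ys ! (i - 1)} = {j \<in> ?S. \<tau> j \<le> \<tau> i}"
    using assms unfolding normalizes_def by (auto simp: not_less[symmetric] simp del: not_less)
  have bd: "\<tau> i \<in> ?S"
    using img assms(2) by blast
  have "\<tau> ` {j \<in> ?S. \<tau> j \<le> \<tau> i} = {v \<in> \<tau> ` ?S. v \<le> \<tau> i}"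
    by blast
  also have "\<dots> = {1..\<tau> i}"
    unfolding img using bd by auto
  finally have "card (\<tau> ` {j \<in> ?S. \<tau> j \<le> \<tau> i}) = \<tau> i"
    by simp
  moreover have "card (\<tau> ` {j \<in> ?S. \<tau> j \<le> \<tau> i}) = card {j \<in> ?S. \<tau> j \<le> \<tau> i}"
    by (rule card_image) (rule permutes_inj_on[OF perm])
  ultimately show ?thesis
    unfolding eq by simp
qed

lemma normalizes_ex1:
  fixes ys :: "'a::linorder list"
  assumes "distinct ys"
  shows "\<exists>!\<tau>. normalizes \<tau> ys"
proof (rule ex_ex1I)
  let ?S = "{1..length ys}"
  let ?B = "\<lambda>i. {j \<in> ?S. ys ! (j - 1) \<le> ys ! (i - 1)}"
  define \<tau> where "\<tau> i = (if i \<in> ?S then card (?B i) else i)" for i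
  have mono: "\<tau> i < \<tau> j" if "i \<in> ?S" "j \<in> ?S" "ys ! (i - 1) < ys ! (j - 1)" for i j
  proof -
    have "?B i \<subset> ?B j"
      using that by force
    then have "card (?B i) < card (?B j)"
      by (intro psubset_card_mono) auto
    with that show ?thesis
      by (simp add: \<tau>_def)
  qed
  have dist: "ys ! (i - 1) \<noteq> ys ! (j - 1)" if "i \<in> ?S" "j \<in> ?S" "i \<noteq> j" for i j
    using that assms by (subst nth_eq_iff_index_eq) auto
  have ord: "\<tau> i > \<tau> j \<longleftrightarrow> ys ! (i - 1) > ys ! (j - 1)" if "i \<in> ?S" "j \<in> ?S" for i j
    using mono[of i j] mono[of j i] dist[of i j] that by (cases "i = j") fastforce+
  have inj: "inj_on \<tau> ?S"
  proof (rule inj_onI)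
    fix i j assume *: "i \<in> ?S" "j \<in> ?S" "\<tau> i = \<tau> j"
    show "i = j"
      using ord[of i j] ord[of j i] dist[of i j] * by (metis less_irrefl linorder_neqE)
  qed
  have sub: "\<tau> ` ?S \<subseteq> ?S"
  proof clarify
    fix i assume i: "i \<in> ?S"
    have "card (?B i) \<le> card ?S"
      by (rule card_mono) auto
    moreover have "card (?B i) > 0"
      using i by (subst card_gt_0_iff) auto
    ultimately show "\<tau> i \<in> ?S"
      using i by (simp add: \<tau>_def)
  qed
  have "\<tau> ` ?S = ?S"
    using sub inj by (intro endo_inj_surj) auto
  with inj have "bij_betw \<tau> ?S ?S"
    by (simp add: bij_betw_def)
  then have "\<tau> permutes ?S"
    by (rule bij_imp_permutes) (auto simp: \<tau>_def)
  with ord show "\<exists>\<tau>. normalizes \<tau> ys"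
    unfolding normalizes_def by blast
next
  fix \<tau> \<tau>' assume *: "normalizes \<tau> ys" "normalizes \<tau>' ys"
  show "\<tau> = \<tau>'"
  proof
    fix i
    show "\<tau> i = \<tau>' i"
    proof (cases "i \<in> {1..length ys}")
      case True
      then show ?thesis
        using * by (simp only: normalizes_eq_card)
    next
      case False
      then show ?thesis
        using * unfolding normalizes_def by (metis permutes_not_in)
    qed
  qed
qed

definition remove12 :: "nat \<Rightarrow> (nat \<Rightarrow> nat) \<Rightarrow> nat \<Rightarrow> nat" where
  "remove12 k \<pi> = normalization (filter (\<lambda>v. v \<noteq> 1 \<and> v \<noteq> 2) (map \<pi> [1..<k + 1]))"

end

theory Submission
  imports Defs
begin

text \<open>
  Let \<open>A \<subseteq> [n]\<close> avoid \<open>\<pi>\<close>, and sort the triples of consecutive elements of \<open>A\<close> into classes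
  according to the integer \<open>t\<close> with \<open>H \<le> z - x < 2H\<close>, \<open>H = 2\<^sup>t\<close>, where \<open>x < y < z\<close> is the triple,
  and the residue modulo 6 of \<open>x div H\<close>. Each triple contains a pair at distance less than \<open>H\<close>
  and a pair at distance at least \<open>H\<close>. The values \<open>x div (6H)\<close> of a class form a set avoiding
  \<open>\<pi>'\<close>: in a \<open>\<pi>'\<close>-wave of such values the points at the two positions where the entries 1 and 2
  were removed could be doubled by a short and a long pair respectively, and every other gap changes
  by less than \<open>3H\<close>, whereas distinct gaps differ by at least \<open>6H\<close>. Since a class takes
  each value at most twice, \<open>card A - 2 \<le> 2 \<cdot> 6 \<cdot> \<lfloor>log\<^sub>2 n\<rfloor> \<cdot> g(\<pi>', n)\<close>.
\<close>

section \<open>Waves and the extremal function\<close>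

text \<open>Injectivity of \<open>\<sigma>\<close> makes one implication between values and gaps
  enough: by trichotomy the converse follows.\<close>

lemma is_waveI:
  assumes "inj_on \<sigma> {1..m}"
    and pos: "\<And>i. i \<in> {1..m} \<Longrightarrow> x i < x (i + 1)"
    and gaps: "\<And>i j. i \<in> {1..m} \<Longrightarrow> j \<in> {1..m} \<Longrightarrow> \<sigma> j < \<sigma> i \<Longrightarrow> x (j + 1) - x j < x (i + 1) - x i"
  shows "is_wave m \<sigma> x"
  unfolding is_wave_def
proof (intro conjI ballI)
  show "strict_mono_on {1..m + 1} x"
  proof (rule strict_mono_onI)
    fix r s assume "r \<in> {1..m + 1}" "s \<in> {1..m + 1}" "r < s"
    then have "Suc r \<le> s" "1 \<le> r" "s \<le> m + 1" by auto
    then show "x r < x s"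
    proof (induction s rule: dec_induct)
      case base
      then show ?case using pos[of r] by simp
    next
      case (step s)
      then show ?case using pos[of s] by simp
    qed
  qed
  fix i j assume ij: "i \<in> {1..m}" "j \<in> {1..m}"
  show "x (j + 1) - x j < x (i + 1) - x i \<longleftrightarrow> \<sigma> j < \<sigma> i"
    using gaps[OF ij] gaps[OF ij(2,1)] inj_onD[OF assms(1) _ ij]
    by (cases "\<sigma> i" "\<sigma> j" rule: linorder_cases) auto
qed

lemma wave_g_ge:
  assumes "A \<subseteq> {1..int n}" "\<not> contains_wave m \<sigma> A"
  shows "card A \<le> wave_g m \<sigma> n"
  unfolding wave_g_def using assms wave_g_wf(1) by (intro Max_ge) auto

lemma wave_g_attained:
  obtains A where "A \<subseteq> {1..int n}" "\<not> contains_wave m \<sigma> A" "card A = wave_g m \<sigma> n"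
proof -
  have "wave_g m \<sigma> n \<in> {card A | A. A \<subseteq> {1..int n} \<and> \<not> contains_wave m \<sigma> A}"
    unfolding wave_g_def by (rule Max_in) (fact wave_g_wf)+
  then show ?thesis using that by auto
qed

text \<open>A wave of positive degree has at least two points, so a singleton contains none. This
  bound later absorbs an additive constant.\<close>

lemma wave_g_pos:
  assumes "m \<ge> 1" "n \<ge> 1"
  shows "wave_g m \<sigma> n \<ge> 1"
proof -
  have "\<not> contains_wave m \<sigma> {1}"
  proof
    assume "contains_wave m \<sigma> {1}"
    then obtain x where x: "is_wave m \<sigma> x" "x ` {1..m + 1} \<subseteq> {1}"
      unfolding contains_wave_def by blast
    from x(1) have "strict_mono_on {1..m + 1} x" by (simp add: is_wave_def)
    then have "x 1 < x 2"
      by (rule strict_mono_onD) (use assms in auto)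
    moreover have "1 \<in> {1..m + 1}" "2 \<in> {1..m + 1}" using assms by auto
    ultimately show False using x(2) by (metis image_subset_iff less_irrefl singletonD)
  qed
  then show ?thesis using wave_g_ge[of "{1}" n m \<sigma>] assms by simp
qed

text \<open>For \<open>k < 2\<close> the permutation is the identity, which puts 1 and 2 next to
  each other; for \<open>k = 2\<close> there are only two positions. Hence \<open>k - 2\<close> is a
  genuine subtraction with a positive result.\<close>

lemma degree_ge_3:
  assumes "\<pi> permutes {1..k}" "\<bar>int (inv \<pi> 1) - int (inv \<pi> 2)\<bar> \<ge> 2"
  shows "k \<ge> 3"
proof (rule ccontr)
  assume "\<not> k \<ge> 3"
  then consider "k = 0" | "k = 1" | "k = 2" by linarith
  then show False
  proof cases
    case 1
    then have "\<pi> = id" using assms(1) by simp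
    then show False using assms(2) by simp
  next
    case 2
    then have "\<pi> = id" using assms(1) by simp
    then show False using assms(2) by simp
  next
    case 3
    have "inv \<pi> 1 \<in> {1..k}" "inv \<pi> 2 \<in> {1..k}"
      using permutes_in_image[OF permutes_inv[OF assms(1)]] 3 by auto
    then show False using assms(2) 3 by auto
  qed
qed

section \<open>Deleting the entries 1 and 2\<close>

text \<open>Renumbers positions after \<open>a\<close> and \<open>b\<close> are deleted. With the
  strict comparisons and \<open>a \<noteq> b\<close>, it also sends \<open>a\<close> and
  \<open>a + 1\<close> to one index, and likewise \<open>b\<close> and \<open>b + 1\<close>; so on
  the points of a wave it undoes the doubling of two points.\<close>

definition contract :: "nat \<Rightarrow> nat \<Rightarrow> nat \<Rightarrow> nat" where
  "contract a b j = j - of_bool (a < j) - of_bool (b < j)"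

lemma contract_commute: "contract a b = contract b a"
  by (auto simp: contract_def fun_eq_iff)

text \<open>The deleted positions cut the index range into three intervals, on which
  \<open>contract\<close> shifts by 0, 1 and 2. The further \<open>- 1\<close> passes from 1-based
  positions to 0-based list indices.\<close>

lemma filter_map_remove_two:
  assumes "lo \<ge> 1" "lo < hi" "hi \<le> k"
    and P: "\<And>i. i \<in> {1..k} \<Longrightarrow> P (f i) \<longleftrightarrow> i \<noteq> lo \<and> i \<noteq> hi"
  defines "ys \<equiv> filter P (map f [1..<k + 1])"
  shows "length ys = k - 2"
    and "\<And>i. i \<in> {1..k} \<Longrightarrow> i \<noteq> lo \<Longrightarrow> i \<noteq> hi \<Longrightarrow> ys ! (contract lo hi i - 1) = f i"
proof -
  have split: "[1..<k + 1] = [1..<lo] @ lo # [lo + 1..<hi] @ hi # [hi + 1..<k + 1]"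
    using assms(1-3) upt_add_eq_append[of 1 lo "k + 1 - lo"]
      upt_add_eq_append[of "lo + 1" hi "k + 1 - hi"]
    by (simp add: upt_conv_Cons del: upt_Suc)
  have "filter (P \<circ> f) [1..<k + 1] = filter (\<lambda>i. i \<noteq> lo \<and> i \<noteq> hi) [1..<k + 1]"
    by (rule filter_cong) (auto simp: P)
  then have "ys = map f (filter (\<lambda>i. i \<noteq> lo \<and> i \<noteq> hi) [1..<k + 1])"
    by (simp add: ys_def filter_map del: upt_Suc)
  also have "\<dots> = map f ([1..<lo] @ [lo + 1..<hi] @ [hi + 1..<k + 1])"
    unfolding split using assms(2) by (simp add: filter_id_conv del: upt_Suc)
  finally have ys: "ys = map f ([1..<lo] @ [lo + 1..<hi] @ [hi + 1..<k + 1])" .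
  show "length ys = k - 2"
    unfolding ys using assms(1-3) by (simp del: upt_Suc)
  fix i assume "i \<in> {1..k}" "i \<noteq> lo" "i \<noteq> hi"
  then consider "1 \<le> i" "i < lo" | "lo < i" "i < hi" | "hi < i" "i \<le> k"
    by fastforce
  then show "ys ! (contract lo hi i - 1) = f i"
    by cases (use assms(1-3) in \<open>auto simp: ys contract_def nth_append simp del: upt_Suc\<close>)
qed

text \<open>The wave argument uses the normalized permutation only through the order of its values,
  read here at the original positions.\<close>

lemma remove12_less_iff:
  assumes perm: "\<pi> permutes {1..k}" and "k \<ge> 2"
    and ij: "i \<in> {1..k} - {inv \<pi> 1, inv \<pi> 2}" "j \<in> {1..k} - {inv \<pi> 1, inv \<pi> 2}"
  shows "remove12 k \<pi> (contract (inv \<pi> 1) (inv \<pi> 2) j) < remove12 k \<pi> (contract (inv \<pi> 1) (inv \<pi> 2) i)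
    \<longleftrightarrow> \<pi> j < \<pi> i"
proof -
  define a b where "a = inv \<pi> 1" and "b = inv \<pi> 2"
  define ys where "ys = filter (\<lambda>v. v \<noteq> 1 \<and> v \<noteq> 2) (map \<pi> [1..<k + 1])"
  have range: "a \<in> {1..k}" "b \<in> {1..k}"
    unfolding a_def b_def
    using permutes_in_image[OF permutes_inv[OF perm]] \<open>k \<ge> 2\<close> by auto
  have ne: "a \<noteq> b"
    unfolding a_def b_def using injD[OF permutes_inj[OF permutes_inv[OF perm]], of 1 2] by auto
  have entries: "\<pi> i \<noteq> 1 \<and> \<pi> i \<noteq> 2 \<longleftrightarrow> i \<noteq> a \<and> i \<noteq> b" for i
    unfolding a_def b_def using permutes_inv_eq[OF perm] by metis
  \<comment> \<open>Either of \<open>a\<close> and \<open>b\<close> may come first, while the list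
    lemma wants sorted positions; symmetry of \<open>contract\<close> merges the two cases.\<close>
  have aux: "length ys = k - 2 \<and> (\<forall>i \<in> {1..k} - {a, b}. ys ! (contract lo hi i - 1) = \<pi> i)"
    if "{lo, hi} = {a, b}" "lo < hi" for lo hi
  proof -
    have *: "1 \<le> lo" "hi \<le> k" using that(1) range by (auto simp: doubleton_eq_iff)
    have "\<pi> i \<noteq> 1 \<and> \<pi> i \<noteq> 2 \<longleftrightarrow> i \<noteq> lo \<and> i \<noteq> hi" for i
      using entries[of i] that(1) by (auto simp: doubleton_eq_iff)
    note filter_map_remove_two[where P = "\<lambda>v. v \<noteq> 1 \<and> v \<noteq> 2" and f = \<pi>,
        OF *(1) that(2) *(2) this, folded ys_def]
    moreover have "i \<noteq> lo" "i \<noteq> hi" if "i \<notin> {a, b}" for i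
      using that \<open>{lo, hi} = {a, b}\<close> by auto
    ultimately show ?thesis by (meson DiffE)
  qed
  have ys: "length ys = k - 2 \<and> (\<forall>i \<in> {1..k} - {a, b}. ys ! (contract a b i - 1) = \<pi> i)"
    using aux[of a b] aux[of b a] ne by (metis contract_commute insert_commute linorder_neqE_nat)
  have "distinct ys"
    unfolding ys_def
    by (intro distinct_filter) (simp add: distinct_map permutes_inj_on[OF perm] del: upt_Suc)
  then have "normalizes (remove12 k \<pi>) ys"
    unfolding remove12_def normalization_def ys_def[symmetric]
    by (rule theI'[OF normalizes_ex1])
  moreover have "contract a b l \<in> {1..k - 2}" if "l \<in> {1..k} - {a, b}" for l
    using that range ne by (auto simp: contract_def of_bool_def)
  ultimately show ?thesis
    using ij ys unfolding normalizes_def a_def[symmetric] b_def[symmetric] by auto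
qed

section \<open>Lifting a wave of cluster indices to a wave of points\<close>

text \<open>The gaps fall into separate ranges: the short one is below \<open>H\<close>, the long
  one is at least \<open>H\<close> and below \<open>3 * H\<close>, all others exceed
  \<open>3 * H\<close>. This realizes the entries 1, 2 and the rest; among the rest, the factor
  \<open>6 * H\<close> outweighs the displacement inside the windows.\<close>

lemma contains_wave_of_clusters:
  fixes A B :: "int set" and H s :: int
  assumes perm: "\<pi> permutes {1..k}" and sep: "\<bar>int (inv \<pi> 1) - int (inv \<pi> 2)\<bar> \<ge> 2"
    and H: "H > 0"
    and clusters: "\<And>p. p \<in> B \<Longrightarrow> \<exists>u v u' v'.
      {u, v, u', v'} \<subseteq> A \<inter> {6 * H * p + s ..< 6 * H * p + s + 3 * H} \<and>
      u < v \<and> v - u < H \<and> H \<le> v' - u'"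
    and wave: "contains_wave (k - 2) (remove12 k \<pi>) B"
  shows "contains_wave k \<pi> A"
proof -
  define a b where "a = inv \<pi> 1" and "b = inv \<pi> 2"
  let ?\<phi> = "contract a b"
  have k: "k \<ge> 3" using degree_ge_3[OF perm sep] .
  have range: "a \<in> {1..k}" "b \<in> {1..k}"
    unfolding a_def b_def
    using permutes_in_image[OF permutes_inv[OF perm]] k by auto
  have sep': "\<bar>int a - int b\<bar> \<ge> 2" using sep unfolding a_def b_def .
  have entries: "\<pi> a = 1" "\<pi> b = 2"
    unfolding a_def b_def using permutes_inverses[OF perm] by auto
  obtain w where w: "is_wave (k - 2) (remove12 k \<pi>) w" and wB: "w ` {1..k - 2 + 1} \<subseteq> B"
    using wave by (auto simp: contains_wave_def)
  obtain u v u' v' where c: "\<And>p. p \<in> B \<Longrightarrow>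
      {u p, v p, u' p, v' p} \<subseteq> A \<inter> {6 * H * p + s ..< 6 * H * p + s + 3 * H} \<and>
      u p < v p \<and> v p - u p < H \<and> H \<le> v' p - u' p"
    using clusters by metis
  \<comment> \<open>Non-adjacency makes \<open>a\<close>, \<open>a + 1\<close>, \<open>b\<close>,
    \<open>b + 1\<close> distinct, so no position has to serve both the short and the long pair. The
    final \<open>u\<close> is an arbitrary choice of a point in the cluster.\<close>
  define x where "x j =
    (if j = a then u else if j = a + 1 then v else if j = b then u' else if j = b + 1 then v' else u)
      (w (?\<phi> j))" for j
  have \<phi>B: "w (?\<phi> j) \<in> B" if "j \<in> {1..k + 1}" for j
  proof -
    have "?\<phi> j \<in> {1..k - 2 + 1}"
      using that range sep' k unfolding contract_def of_bool_def
      by (cases "a < j"; cases "b < j") auto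
    then show ?thesis using wB by blast
  qed
  have x_in: "x j \<in> A" "6 * H * w (?\<phi> j) + s \<le> x j" "x j < 6 * H * w (?\<phi> j) + s + 3 * H"
    if "j \<in> {1..k + 1}" for j
    using c[OF \<phi>B[OF that]] by (auto simp: x_def)
  have \<phi>_same: "?\<phi> (a + 1) = ?\<phi> a" "?\<phi> (b + 1) = ?\<phi> b"
    using sep' by (auto simp: contract_def)
  have gap_a: "0 < x (a + 1) - x a" "x (a + 1) - x a < H"
    using c[OF \<phi>B[of a]] range \<phi>_same by (auto simp: x_def)
  have gap_b: "H \<le> x (b + 1) - x b"
    using c[OF \<phi>B[of b]] range \<phi>_same sep' by (auto simp: x_def)
  have gap_b': "x (b + 1) - x b < 3 * H"
    using x_in[of b] x_in[of "b + 1"] range \<phi>_same by auto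
  have \<phi>_step: "?\<phi> (j + 1) = ?\<phi> j + 1" "?\<phi> j \<in> {1..k - 2}" if "j \<in> {1..k} - {a, b}" for j
    using that range sep' by (auto simp: contract_def of_bool_def)
  have gap: "\<bar>x (j + 1) - x j - 6 * H * (w (?\<phi> j + 1) - w (?\<phi> j))\<bar> < 3 * H"
    if "j \<in> {1..k} - {a, b}" for j
    using x_in(2,3)[of j] x_in(2,3)[of "j + 1"] \<phi>_step[OF that] that by (auto simp: algebra_simps)
  have gap_large: "3 * H < x (j + 1) - x j" if "j \<in> {1..k} - {a, b}" for j
  proof -
    have "w (?\<phi> j) < w (?\<phi> j + 1)"
      using w \<phi>_step[OF that] by (auto simp: is_wave_def intro: strict_mono_onD)
    then have "6 * H * 1 \<le> 6 * H * (w (?\<phi> j + 1) - w (?\<phi> j))"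
      using H by (intro mult_left_mono) auto
    then show ?thesis using gap[OF that] by linarith
  qed
  have "is_wave k \<pi> x"
  proof (rule is_waveI)
    show "inj_on \<pi> {1..k}" using permutes_inj_on[OF perm] .
    show "x i < x (i + 1)" if "i \<in> {1..k}" for i
    proof -
      consider "i = a" | "i = b" | "i \<in> {1..k} - {a, b}"
        using \<open>i \<in> {1..k}\<close> by blast
      then show ?thesis
        by cases (use gap_a gap_b gap_large[of i] H in auto)
    qed
    fix i j assume ij: "i \<in> {1..k}" "j \<in> {1..k}" "\<pi> j < \<pi> i"
    have "\<pi> j \<ge> 1" using permutes_in_image[OF perm] ij(2) by force
    then have "i \<noteq> a" using ij entries by auto
    have inj: "\<pi> j = 1 \<longleftrightarrow> j = a"
      using entries permutes_inj[OF perm] by (metis injD)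
    \<comment> \<open>The entry at \<open>a\<close> is the least, so \<open>i\<close> is not
      \<open>a\<close>; if \<open>i = b\<close>, only \<open>j = a\<close> has a smaller
      entry.\<close>
    consider "i = b" "j = a" | "i \<in> {1..k} - {a, b}" "j \<in> {a, b}"
      | "i \<in> {1..k} - {a, b}" "j \<in> {1..k} - {a, b}"
      using ij \<open>i \<noteq> a\<close> \<open>\<pi> j \<ge> 1\<close> inj entries by fastforce
    then show "x (j + 1) - x j < x (i + 1) - x i"
    proof cases
      case 1
      then show ?thesis using gap_a gap_b by simp
    next
      case 2
      then show ?thesis using gap_a gap_b gap_b' gap_large[of i] H by fastforce
    next
      case 3
      have "remove12 k \<pi> (?\<phi> j) < remove12 k \<pi> (?\<phi> i)"
        using remove12_less_iff[OF perm, of i j] 3 ij(3) k by (simp add: a_def b_def)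
      then have "w (?\<phi> j + 1) - w (?\<phi> j) < w (?\<phi> i + 1) - w (?\<phi> i)"
        using w \<phi>_step(2)[OF 3(1)] \<phi>_step(2)[OF 3(2)] unfolding is_wave_def by blast
      \<comment> \<open>Gaps of \<open>w\<close> are integers, so a strict inequality gains a full
        \<open>6 * H\<close>; the two errors, each below \<open>3 * H\<close>, cannot use it
        up.\<close>
      then have "6 * H * (w (?\<phi> j + 1) - w (?\<phi> j) + 1) \<le> 6 * H * (w (?\<phi> i + 1) - w (?\<phi> i))"
        using H by (intro mult_left_mono) auto
      then have "6 * H * (w (?\<phi> j + 1) - w (?\<phi> j)) + 6 * H \<le> 6 * H * (w (?\<phi> i + 1) - w (?\<phi> i))"
        by (simp add: algebra_simps)
      then show ?thesis using gap[OF 3(1)] gap[OF 3(2)] by linarith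
    qed
  qed
  moreover have "x ` {1..k + 1} \<subseteq> A" using x_in(1) by blast
  ultimately show ?thesis by (auto simp: contains_wave_def)
qed

section \<open>Counting triples of consecutive elements\<close>

lemma card_le_2_of_close:
  fixes F :: "nat set"
  assumes "\<And>i j. i \<in> F \<Longrightarrow> j \<in> F \<Longrightarrow> j < i + 2"
  shows "card F \<le> 2"
proof (cases "F = {}")
  case False
  define i where "i = (LEAST i. i \<in> F)"
  have "i \<in> F" "\<And>j. j \<in> F \<Longrightarrow> i \<le> j"
    unfolding i_def using False by (auto intro: LeastI Least_le)
  then have "F \<subseteq> {i, i + 1}" using assms[OF \<open>i \<in> F\<close>] by fastforce
  then have "card F \<le> card {i, i + 1}" by (intro card_mono) auto
  then show ?thesis by simp
qed auto

lemma card_le_fibres: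
  assumes "finite I" and "\<And>b. card {i \<in> I. f i = b} \<le> c"
  shows "card I \<le> c * card (f ` I)"
proof -
  have "I = (\<Union>b \<in> f ` I. {i \<in> I. f i = b})" by auto
  then have "card I \<le> (\<Sum>b \<in> f ` I. card {i \<in> I. f i = b})"
    using card_UN_le[of "f ` I" "\<lambda>b. {i \<in> I. f i = b}"] assms(1) by simp
  also have "\<dots> \<le> (\<Sum>b \<in> f ` I. c)" by (intro sum_mono assms)
  finally show ?thesis by (simp add: mult.commute)
qed

lemma card_no_wave_le:
  assumes perm: "\<pi> permutes {1..k}" and sep: "\<bar>int (inv \<pi> 1) - int (inv \<pi> 2)\<bar> \<ge> 2"
    and A: "A \<subseteq> {1..int n}" "\<not> contains_wave k \<pi> A"
  shows "card A \<le> 2 + 12 * nat \<lfloor>log 2 n\<rfloor> * wave_g (k - 2) (remove12 k \<pi>) n"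
proof -
  define m where "m = card A"
  define N where "N = nat \<lfloor>log 2 n\<rfloor>"
  define g' where "g' = wave_g (k - 2) (remove12 k \<pi>) n"
  define a where "a i = sorted_list_of_set A ! i" for i
  have fin: "finite A" using A(1) by (rule finite_subset) simp
  have a_less: "a i < a j" if "i < j" "j < m" for i j
    unfolding a_def using that sorted_wrt_nth_less[OF strict_sorted_list_of_set, of i j A] fin
    by (simp add: m_def)
  have a_le: "a i \<le> a j" if "i \<le> j" "j < m" for i j
    using a_less[of i j] that by (cases "i = j") auto
  have a_in: "a i \<in> A" if "i < m" for i
    unfolding a_def using that fin nth_mem[of i "sorted_list_of_set A"] by (simp add: m_def)
  have a_range: "a i \<in> {1..int n}" if "i < m" for i
    using a_in[OF that] A(1) by blast
  \<comment> \<open>A triple is represented by the 0-based index of its first element, whence the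
    bound \<open>m - 2\<close>.\<close>
  define I where "I t r = {i. i < m - 2 \<and> 2 ^ t \<le> a (i + 2) - a i \<and> a (i + 2) - a i < 2 ^ (t + 1)
      \<and> (a i div 2 ^ t) mod 6 = r}" for t :: nat and r :: int
  have I_card: "card (I t r) \<le> 2 * g'" for t r
  proof -
    define H :: int where "H = 2 ^ t"
    have H: "H > 0" by (simp add: H_def)
    \<comment> \<open>The \<open>+ 1\<close> keeps the values positive, as subsets of
      \<open>{1..int n}\<close> require; the offset \<open>H * (r - 6)\<close> below compensates for
      it.\<close>
    define p where "p i = (a i div H) div 6 + 1" for i
    have start: "6 * H * p i + H * (r - 6) \<le> a i" "a i < 6 * H * p i + H * (r - 6) + H"
      if "i \<in> I t r" for i
    proof -
      have "a i div H = 6 * (p i - 1) + r"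
        using that mult_div_mod_eq[of 6 "a i div H"] by (simp add: p_def I_def H_def)
      then have "a i = H * (6 * (p i - 1) + r) + a i mod H"
        by (metis mult_div_mod_eq)
      then have "a i = 6 * H * p i + H * (r - 6) + a i mod H" by (simp add: algebra_simps)
      moreover have "0 \<le> a i mod H" "a i mod H < H" using H by auto
      ultimately show "6 * H * p i + H * (r - 6) \<le> a i" "a i < 6 * H * p i + H * (r - 6) + H"
        by linarith+
    qed
    \<comment> \<open>Indices at distance at least 2 have elements at least \<open>H\<close> apart,
      but a common value of \<open>p\<close> puts both elements in one half-open window of length
      \<open>H\<close>.\<close>
    have "card {i \<in> I t r. p i = b} \<le> 2" for b
    proof (rule card_le_2_of_close)
      fix i j assume ij: "i \<in> {i \<in> I t r. p i = b}" "j \<in> {i \<in> I t r. p i = b}"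
      show "j < i + 2"
      proof (rule ccontr)
        assume "\<not> j < i + 2"
        then have "a (i + 2) \<le> a j" using ij by (intro a_le) (auto simp: I_def)
        moreover have "a i + H \<le> a (i + 2)" using ij by (auto simp: I_def H_def)
        moreover have *: "i \<in> I t r" "j \<in> I t r" "p i = b" "p j = b" using ij by auto
        ultimately show False
          using start(1)[OF *(1)] start(2)[OF *(2)] by auto
      qed
    qed
    moreover have "finite (I t r)" by (simp add: I_def)
    ultimately have "card (I t r) \<le> 2 * card (p ` I t r)"
      by (intro card_le_fibres)
    also have "card (p ` I t r) \<le> g'"
      unfolding g'_def
    proof (rule wave_g_ge)
      show "p ` I t r \<subseteq> {1..int n}"
      proof clarify
        fix i assume "i \<in> I t r"
        then have "a i \<in> {1..int n}" by (intro a_range) (auto simp: I_def)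
        then have ai: "1 \<le> a i" "a i \<le> int n" by auto
        have "0 \<le> a i div H" "a i div H \<le> a i"
          using ai H zdiv_mono2[of "a i" 1 H] by (auto simp: pos_imp_zdiv_nonneg_iff)
        then have "0 \<le> (a i div H) div 6" "(a i div H) div 6 + 1 \<le> int n" using ai by linarith+
        then show "p i \<in> {1..int n}" by (simp add: p_def)
      qed
      show "\<not> contains_wave (k - 2) (remove12 k \<pi>) (p ` I t r)"
      proof
        assume wave: "contains_wave (k - 2) (remove12 k \<pi>) (p ` I t r)"
        have "contains_wave k \<pi> A"
        proof (rule contains_wave_of_clusters[OF perm sep H _ wave])
          fix q assume "q \<in> p ` I t r"
          then obtain i where i: "i \<in> I t r" "q = p i" by auto
          let ?C = "A \<inter> {6 * H * q + H * (r - 6) ..< 6 * H * q + H * (r - 6) + 3 * H}"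
          have im: "i + 2 < m" using i by (auto simp: I_def)
          have span: "H \<le> a (i + 2) - a i" "a (i + 2) - a i < 2 * H"
            using i by (auto simp: I_def H_def)
          have less: "a i < a (i + 1)" "a (i + 1) < a (i + 2)" using a_less im by auto
          \<comment> \<open>The first element lies in a window of length \<open>H\<close> and the
            triple spans less than \<open>2 * H\<close>, hence the length
            \<open>3 * H\<close>.\<close>
          have C: "a i \<in> ?C" "a (i + 1) \<in> ?C" "a (i + 2) \<in> ?C"
            using start[OF i(1)] span less a_in im i(2) by auto
          \<comment> \<open>Two gaps with sum below \<open>2 * H\<close> cannot both reach
            \<open>H\<close>, so one of them gives the short pair; the outer elements form the long
            pair.\<close>
          have "a (i + 1) - a i < H \<or> a (i + 2) - a (i + 1) < H" using span by linarith
          then show "\<exists>u v u' v'. {u, v, u', v'} \<subseteq> ?C \<and> u < v \<and> v - u < H \<and> H \<le> v' - u'"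
            using C less span(1) by (meson empty_subsetI insert_subset)
        qed
        with A(2) show False by contradiction
      qed
    qed
    finally show ?thesis by simp
  qed
  have "{..<m - 2} \<subseteq> (\<Union>t \<in> {1..N}. \<Union>r \<in> {0..<6}. I t r)"
  proof
    fix i assume "i \<in> {..<m - 2}"
    then have i: "i + 2 < m" by auto
    define e where "e = nat (a (i + 2) - a i)"
    have "a i < a (i + 1)" "a (i + 1) < a (i + 2)" using a_less i by auto
    then have e: "int e = a (i + 2) - a i" "e \<ge> 2" by (auto simp: e_def)
    have "a i \<in> {1..int n}" "a (i + 2) \<in> {1..int n}" using a_range i by simp_all
    then have en: "e \<le> n" using e by auto
    obtain t where t: "2 ^ t \<le> e" "e < 2 ^ (t + 1)"
      using ex_power_ivl1[of 2 e] e by auto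
    \<comment> \<open>Three increasing integers span at least 2, so scale 0 is empty and only
      \<open>N\<close> scales remain.\<close>
    have "t \<noteq> 0" using t e by (intro notI) auto
    have "2 ^ t \<le> n" using t en by simp
    then have "real t \<le> log 2 n" by (rule le_log2_of_power)
    then have "t \<le> N" unfolding N_def by linarith
    have "int (2 ^ t) \<le> int e" "int e < int (2 ^ (t + 1))" using t by linarith+
    then have "i \<in> I t ((a i div 2 ^ t) mod 6)"
      using i e by (auto simp: I_def)
    moreover have "(a i div 2 ^ t) mod 6 \<in> {0..<6}" by auto
    ultimately show "i \<in> (\<Union>t \<in> {1..N}. \<Union>r \<in> {0..<6}. I t r)"
      using \<open>t \<noteq> 0\<close> \<open>t \<le> N\<close> by fastforce
  qed
  then have "card {..<m - 2} \<le> card (\<Union>t \<in> {1..N}. \<Union>r \<in> {0..<6}. I t r)"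
    by (intro card_mono) (auto simp: I_def)
  also have "\<dots> \<le> (\<Sum>t \<in> {1..N}. card (\<Union>r \<in> {0..<6}. I t r))"
    by (rule card_UN_le) simp
  also have "\<dots> \<le> (\<Sum>t \<in> {1..N}. \<Sum>r \<in> {0..<6}. card (I t r))"
    by (intro sum_mono card_UN_le) simp
  also have "\<dots> \<le> (\<Sum>t \<in> {1..N}. \<Sum>r \<in> {0..<6::int}. 2 * g')"
    by (intro sum_mono I_card)
  finally have "m - 2 \<le> 12 * N * g'" by simp
  then show ?thesis unfolding m_def N_def g'_def by linarith
qed

theorem theorem1p12:
  fixes k n :: nat and \<pi> :: "nat \<Rightarrow> nat"
  assumes "\<pi> permutes {1..k}"
    and "\<bar>int (inv \<pi> 1) - int (inv \<pi> 2)\<bar> \<ge> 2"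
    and "n > 1"
  shows "real (wave_g k \<pi> n) \<le> 42 * log 2 (real n) * real (wave_g (k - 2) (remove12 k \<pi>) n)"
proof -
  define g' where "g' = wave_g (k - 2) (remove12 k \<pi>) n"
  obtain A where A: "A \<subseteq> {1..int n}" "\<not> contains_wave k \<pi> A" "card A = wave_g k \<pi> n"
    by (rule wave_g_attained)
  have log: "1 \<le> log 2 n" using assms(3) by simp
  have "wave_g k \<pi> n \<le> 2 + 12 * nat \<lfloor>log 2 n\<rfloor> * g'"
    using card_no_wave_le[OF assms(1,2) A(1,2)] A(3) by (simp add: g'_def)
  then have "real (wave_g k \<pi> n) \<le> 2 + 12 * real (nat \<lfloor>log 2 n\<rfloor>) * real g'"
    by (simp flip: of_nat_le_iff[where 'a = real])
  also have "\<dots> \<le> 2 + 12 * log 2 n * real g'"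
  proof -
    have "real (nat \<lfloor>log 2 n\<rfloor>) \<le> log 2 n" using log by linarith
    then show ?thesis by (intro add_left_mono mult_right_mono mult_left_mono) auto
  qed
  also have "\<dots> \<le> 42 * log 2 n * real g'"
  proof -
    have "g' \<ge> 1"
      unfolding g'_def using degree_ge_3[OF assms(1,2)] assms(3) by (intro wave_g_pos) auto
    \<comment> \<open>The summand 2 is thus at most twice this product, so 14 times the product
      bounds the sum, within the factor 42.\<close>
    then have "1 * 1 \<le> log 2 n * real g'" using log by (intro mult_mono) auto
    then show ?thesis by linarith
  qed
  finally show ?thesis by (simp add: g'_def)
qed

end
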